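(* Let $n\in\mathbb N$ and let $\mu$ be a positive Borel measure on $T_\Omega$. Then $\mu$ is a Carleson measure for $H^n_{2,\rho}(T_\Omega)$ if and only if there exists a constant $C>0$ such that $$\int_{T_\Omega}|(\mathcal Lf)(z)|^2\,d\mu(z)\le C\|f\|^2_{L^2(\Omega^\ast,w_n)}$$ for all $f\in L^2(\Omega^\ast,w_n)$.
   Context: Let $d\ge 1$ and let $\Omega\subset\mathbb R^d$ be a nonempty open convex cone containing no complete straight line. Its dual cone is $\Omega^\ast=\{\xi\in\mathbb R^d:\langle x,\xi\rangle\ge 0\text{ for all }x\in\Omega\}$, and $T_\Omega=\mathbb R^d+i\Omega\subset\mathbb C^d$ is the associated tube domain. For $z\in\mathbb C^d$, $\xi\in\mathbb R^d$, $\langle z,\xi\rangle=\sum_{j=1}^d z_j\xi_j$ (bilinear). Fix a continuous function $\rho:\Omega^\ast\to[0,\infty)$ with $\rho(\xi)>0$ for $\xi\ne 0$ and $\rho(t\xi)=t\rho(\xi)$ for all $t>0$, $\xi\in\Omega^\ast$ (so $\rho(0)=0$). For $n\in\mathbb N$ let $w_n(\xi)=\sum_{k=0}^n\rho(\xi)^{2k}$, and let $L^2(\Omega^\ast,w_n)$ be the space of (classes of) measurable complex functions $f$ on $\Omega^\ast$ with $\|f\|_{L^2(\Omega^\ast,w_n)}^2=\int_{\Omega^\ast}|f|^2w_n\,d\xi<\infty$. The Fourier--Laplace transform is $\mathcal Lf(z)=\int_{\Omega^\ast}e^{i\langle z,\xi\rangle}f(\xi)\,d\xi$, $z\in T_\Omega$.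 The Hilbertian Hardy--Sobolev space $H^n_{2,\rho}(T_\Omega)$ consists of all holomorphic functions $F$ on $T_\Omega$ of the form $F=\mathcal Lf$ with $f\in L^2(\Omega^\ast,w_n)$, with norm $\|F\|_{H^n_{2,\rho}(T_\Omega)}=\inf\{\|f\|_{L^2(\Omega^\ast,w_n)}:F=\mathcal Lf\}$. A positive Borel measure $\mu$ on $T_\Omega$ is a Carleson measure for $H^n_{2,\rho}(T_\Omega)$ if there is $C>0$ with $\int_{T_\Omega}|F|^2\,d\mu\le C\|F\|^2_{H^n_{2,\rho}(T_\Omega)}$ for all $F\in H^n_{2,\rho}(T_\Omega)$. *)

theory Defs
  imports "HOL-Analysis.Analysis"
begin

text \<open>The library's \<open>cone\<close> requires closure under multiplication by \<open>0\<close> as well; a nonempty open cone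
  other than the whole space does not contain the origin, so only positive factors are allowed here.\<close>

definition positive_cone :: "'a::real_vector set \<Rightarrow> bool" where
  "positive_cone S \<longleftrightarrow> (\<forall>x\<in>S. \<forall>t>0. t *\<^sub>R x \<in> S)"

definition contains_line :: "'a::real_vector set \<Rightarrow> bool" where
  "contains_line S \<longleftrightarrow> (\<exists>x v. v \<noteq> 0 \<and> (\<forall>t. x + t *\<^sub>R v \<in> S))"

definition dual_cone :: "'a::real_inner set \<Rightarrow> 'a set" where
  "dual_cone S = {\<xi>. \<forall>x\<in>S. x \<bullet> \<xi> \<ge> 0}"

definition tube :: "(real^'d) set \<Rightarrow> (complex^'d) set" where
  "tube S = {z. (\<chi> j. Im (z $ j)) \<in> S}"

definition bilin :: "complex^'d \<Rightarrow> real^'d \<Rightarrow> complex" where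
  "bilin z \<xi> = (\<Sum>j\<in>UNIV. z $ j * of_real (\<xi> $ j))"

text \<open>Holomorphy in several variables: the real Frechet derivative exists at each point
  and is complex linear. Intended for open sets.\<close>

definition holomorphic_vec_on :: "(complex^'d \<Rightarrow> complex) \<Rightarrow> (complex^'d) set \<Rightarrow> bool" where
  "holomorphic_vec_on F U \<longleftrightarrow>
     (\<forall>z\<in>U. \<exists>F'. (F has_derivative F') (at z) \<and> (\<forall>c v. F' (c *s v) = c * F' v))"

definition sobolev_weight :: "('a \<Rightarrow> real) \<Rightarrow> nat \<Rightarrow> 'a \<Rightarrow> real" where
  "sobolev_weight \<rho> n \<xi> = (\<Sum>k=0..n. \<rho> \<xi> ^ (2 * k))"

text \<open>Elements of \<open>L2_weight S w\<close> are representatives, i.e. functions and not classes modulo null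
  sets. The value of \<open>L2_norm\<close> and of the Fourier--Laplace transform depends only on the class.
  Values outside \<open>S\<close> are irrelevant.\<close>

definition L2_weight :: "'a::euclidean_space set \<Rightarrow> ('a \<Rightarrow> real) \<Rightarrow> ('a \<Rightarrow> complex) set" where
  "L2_weight S w = {f. f \<in> borel_measurable (lebesgue_on S) \<and>
     (\<integral>\<^sup>+\<xi>. ennreal ((cmod (f \<xi>))\<^sup>2 * w \<xi>) \<partial>lebesgue_on S) < \<infinity>}"

definition L2_norm :: "'a::euclidean_space set \<Rightarrow> ('a \<Rightarrow> real) \<Rightarrow> ('a \<Rightarrow> complex) \<Rightarrow> real" where
  "L2_norm S w f = sqrt (\<integral>\<xi>. (cmod (f \<xi>))\<^sup>2 * w \<xi> \<partial>lebesgue_on S)"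

definition fourier_laplace ::
  "(real^'d) set \<Rightarrow> (real^'d \<Rightarrow> complex) \<Rightarrow> complex^'d \<Rightarrow> complex" where
  "fourier_laplace \<Omega> f z = (\<integral>\<xi>. exp (\<i> * bilin z \<xi>) * f \<xi> \<partial>lebesgue_on (dual_cone \<Omega>))"

text \<open>The set of \<open>f\<close> with \<open>F = \<L>f\<close> on the tube. Functions on the tube are modelled by total functions
  whose values off the tube are irrelevant.\<close>

definition laplace_preimages ::
  "(real^'d) set \<Rightarrow> (real^'d \<Rightarrow> real) \<Rightarrow> nat \<Rightarrow> (complex^'d \<Rightarrow> complex) \<Rightarrow> (real^'d \<Rightarrow> complex) set" where
  "laplace_preimages \<Omega> \<rho> n F = {f \<in> L2_weight (dual_cone \<Omega>) (sobolev_weight \<rho> n).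
     \<forall>z\<in>tube \<Omega>. F z = fourier_laplace \<Omega> f z}"

definition hardy_sobolev ::
  "(real^'d) set \<Rightarrow> (real^'d \<Rightarrow> real) \<Rightarrow> nat \<Rightarrow> (complex^'d \<Rightarrow> complex) set" where
  "hardy_sobolev \<Omega> \<rho> n = {F. holomorphic_vec_on F (tube \<Omega>) \<and> laplace_preimages \<Omega> \<rho> n F \<noteq> {}}"

definition hardy_sobolev_norm ::
  "(real^'d) set \<Rightarrow> (real^'d \<Rightarrow> real) \<Rightarrow> nat \<Rightarrow> (complex^'d \<Rightarrow> complex) \<Rightarrow> real" where
  "hardy_sobolev_norm \<Omega> \<rho> n F =
     (INF f\<in>laplace_preimages \<Omega> \<rho> n F. L2_norm (dual_cone \<Omega>) (sobolev_weight \<rho> n) f)"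

definition carleson_measure ::
  "(real^'d) set \<Rightarrow> (real^'d \<Rightarrow> real) \<Rightarrow> nat \<Rightarrow> (complex^'d) measure \<Rightarrow> bool" where
  "carleson_measure \<Omega> \<rho> n \<mu> \<longleftrightarrow> (\<exists>C>0. \<forall>F\<in>hardy_sobolev \<Omega> \<rho> n.
     (\<integral>\<^sup>+z. ennreal ((cmod (F z))\<^sup>2) \<partial>\<mu>) \<le> ennreal (C * (hardy_sobolev_norm \<Omega> \<rho> n F)\<^sup>2))"

end

theory Submission
  imports Defs
begin

text \<open>
  If the Laplace-side inequality holds, then for a given \<open>F\<close> it bounds \<open>\<integral>\<bar>F\<bar>\<^sup>2 d\<mu>\<close> by \<open>C \<parallel>f\<parallel>\<^sup>2\<close> for every
  preimage \<open>f\<close> of \<open>F\<close>, because \<open>\<mu>\<close> lives on the tube, where \<open>F = \<L>f\<close>; passing to the infimum over \<open>f\<close>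
  gives the Carleson inequality with the same constant (\<open>le_Inf_square\<close>). Conversely, \<open>\<parallel>\<L>f\<parallel> \<le> \<parallel>f\<parallel>\<close> by
  the definition of the norm as an infimum, so the Carleson inequality for \<open>F = \<L>f\<close> gives the
  other one, provided that \<open>\<L>f\<close> belongs to the space at all. That is the analytic content: the
  Fourier--Laplace transform of every \<open>f \<in> L\<^sup>2(\<Omega>\<^sup>*, w\<^sub>n)\<close> is holomorphic on the tube
  (\<open>holomorphic_fourier_laplace\<close>).

  For the holomorphy, let \<open>z = x + iy\<close> with \<open>y \<in> \<Omega>\<close>. As \<open>\<Omega>\<close> contains a ball of some radius \<open>\<delta>\<close>
  around \<open>y\<close>, duality gives \<open>\<langle>y, \<xi>\<rangle> \<ge> \<delta> \<bar>\<xi>\<bar>\<close> on \<open>\<Omega>\<^sup>*\<close> (\<open>dual_cone_coercive\<close>), so that the kernel decays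
  like \<open>e\<^bsup>-\<delta>\<bar>\<xi>\<bar>\<^esup>\<close>. By the inequality \<open>\<bar>e\<^sup>w - 1 - w\<bar> \<le> \<bar>w\<bar>\<^sup>2 e\<^bsup>\<bar>w\<bar>\<^esup>\<close>, the remainder
  of the first-order expansion of \<open>\<L>f\<close> at \<open>z\<close> is at most
  \<open>\<bar>h\<bar>\<^sup>2 \<integral> \<bar>\<xi>\<bar>\<^sup>2 e\<^bsup>-\<delta>\<bar>\<xi>\<bar>/2\<^esup> \<bar>f(\<xi>)\<bar> d\<xi>\<close> for \<open>\<bar>h\<bar> \<le> \<delta>/2\<close>. The integral is finite because \<open>w\<^sub>n \<ge> 1\<close>
  puts \<open>f\<close> into the unweighted \<open>L\<^sup>2\<close>.
\<close>

section \<open>Exponential decay against square-integrable functions\<close>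

lemma integrable_exp_neg_abs:
  fixes a :: real
  assumes "a > 0"
  shows "integrable lborel (\<lambda>x. exp (- a * \<bar>x\<bar>))"
proof -
  define g :: "real \<Rightarrow> real" where "g x = indicat_real {0..} x * exp (- a * x)" for x
  have "(\<lambda>x. exp (- a * x)) absolutely_integrable_on {0..}"
    using integrable_on_exp_minus_to_infinity[OF assms, of 0]
    by (intro nonnegative_absolutely_integrable_1) auto
  then have "integrable lebesgue g"
    unfolding set_integrable_def g_def by simp
  then have g: "integrable lborel g"
    by (subst (asm) integrable_completion) (simp_all add: g_def[abs_def])
  then have "integrable lborel (\<lambda>x. g (0 + (-1) * x))"
    by (intro lborel_integrable_real_affine) auto
  then have "integrable lborel (\<lambda>x. g x + g (- x))"
    using g by simp
  then show ?thesis
    by (rule Bochner_Integration.integrable_bound)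
       (auto simp: g_def indicator_def abs_if split: if_splits)
qed

text \<open>By \<open>\<bar>x\<bar> \<ge> (1/d) \<Sum>\<^sub>b \<bar>x\<^sub>b\<bar>\<close> the function is dominated by a product of one-dimensional exponentials,
  to which Tonelli applies.\<close>

lemma integrable_exp_neg_norm:
  fixes c :: real
  assumes "c > 0"
  shows "integrable lborel (\<lambda>x::'a::euclidean_space. exp (- c * norm x))"
proof (rule integrableI_nonneg)
  define a where "a = c / DIM('a)"
  have a: "a > 0" using assms by (simp add: a_def)
  have le: "exp (- c * norm x) \<le> (\<Prod>b\<in>Basis. exp (- a * \<bar>x \<bullet> b\<bar>))" for x :: 'a
  proof -
    have "(\<Sum>b\<in>Basis. \<bar>x \<bullet> b\<bar>) \<le> DIM('a) * norm x"
      by (rule sum_bounded_above) (simp add: Basis_le_norm)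
    then have "a * (\<Sum>b\<in>Basis. \<bar>x \<bullet> b\<bar>) \<le> a * (DIM('a) * norm x)"
      using a by (intro mult_left_mono) auto
    also have "\<dots> = c * norm x" by (simp add: a_def)
    finally have "- c * norm x \<le> (\<Sum>b\<in>Basis. - a * \<bar>x \<bullet> b\<bar>)"
      by (simp add: sum_distrib_left sum_negf)
    then show ?thesis by (simp add: exp_sum flip: exp_sum)
  qed
  have fin: "(\<integral>\<^sup>+t. ennreal (exp (- a * \<bar>t\<bar>)) \<partial>lborel) < \<infinity>"
    using integrable_exp_neg_abs[OF a] by (simp add: integrable_iff_bounded)
  have "(\<integral>\<^sup>+x. ennreal (exp (- c * norm x)) \<partial>(lborel :: 'a measure))
      \<le> (\<integral>\<^sup>+x. (\<Prod>b\<in>Basis. ennreal (exp (- a * \<bar>x \<bullet> b\<bar>))) \<partial>(lborel :: 'a measure))"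
    using ennreal_leI[OF le] by (intro nn_integral_mono) (simp only: prod_ennreal exp_ge_zero)
  also have "\<dots> = (\<Prod>b\<in>(Basis::'a set). (\<integral>\<^sup>+t. ennreal (exp (- a * \<bar>t\<bar>)) \<partial>lborel))"
    by (rule nn_integral_lborel_prod) auto
  also have "\<dots> < \<infinity>"
    using fin by (simp add: power_less_top_ennreal)
  finally show "(\<integral>\<^sup>+x. ennreal (exp (- c * norm x)) \<partial>(lborel :: 'a measure)) < \<infinity>" .
qed auto

text \<open>Each power of the norm costs half of the decay rate, since \<open>s \<le> e\<^sup>s\<close>.\<close>

lemma integrable_power_norm_exp:
  fixes c :: real
  assumes "c > 0"
  shows "integrable lborel (\<lambda>x::'a::euclidean_space. norm x ^ m * exp (- c * norm x))"
  using assms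
proof (induction m arbitrary: c)
  case 0
  then show ?case using integrable_exp_neg_norm by auto
next
  case (Suc m)
  have "integrable lborel (\<lambda>x::'a. 2 / c * (norm x ^ m * exp (- (c/2) * norm x)))"
    using Suc.IH[of "c/2"] Suc.prems by (intro integrable_mult_right) auto
  then show ?case
  proof (rule Bochner_Integration.integrable_bound)
    show "AE x::'a in lborel. norm (norm x ^ Suc m * exp (- c * norm x))
        \<le> norm (2 / c * (norm x ^ m * exp (- (c/2) * norm x)))"
    proof (rule AE_I2)
      fix x :: 'a
      have "c/2 * norm x \<le> exp (c/2 * norm x)"
        using exp_ge_add_one_self[of "c/2 * norm x"] by linarith
      then have "norm x \<le> 2 / c * exp (c/2 * norm x)"
        using Suc.prems by (simp add: field_simps)
      then have "norm x ^ m * norm x * exp (- c * norm x)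
          \<le> norm x ^ m * (2 / c * exp (c/2 * norm x)) * exp (- c * norm x)"
        by (intro mult_left_mono mult_right_mono) auto
      also have "\<dots> = 2 / c * (norm x ^ m * (exp (c/2 * norm x) * exp (- c * norm x)))"
        by (simp add: algebra_simps)
      also have "exp (c/2 * norm x) * exp (- c * norm x) = exp (- (c/2) * norm x)"
        by (simp add: field_simps flip: exp_add)
      finally show "norm (norm x ^ Suc m * exp (- c * norm x))
        \<le> norm (2 / c * (norm x ^ m * exp (- (c/2) * norm x)))"
        using Suc.prems by (simp add: abs_mult algebra_simps)
    qed
  qed auto
qed

lemma continuous_borel_measurable_lebesgue_on:
  fixes g :: "'a::euclidean_space \<Rightarrow> 'b::euclidean_space"
  assumes "continuous_on UNIV g" and "S \<in> sets lebesgue"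
  shows "g \<in> borel_measurable (lebesgue_on S)"
  using assms continuous_imp_measurable_on_sets_lebesgue continuous_on_subset by blast

text \<open>Both factors are square-integrable, and \<open>uv \<le> u\<^sup>2 + v\<^sup>2\<close>.\<close>

lemma integrable_power_norm_exp_mult_L2:
  fixes f :: "'a::euclidean_space \<Rightarrow> complex"
  assumes S: "S \<in> sets lebesgue" and f: "f \<in> borel_measurable (lebesgue_on S)"
    and f2: "integrable (lebesgue_on S) (\<lambda>\<xi>. (cmod (f \<xi>))\<^sup>2)" and c: "c > 0"
  shows "integrable (lebesgue_on S) (\<lambda>\<xi>. norm \<xi> ^ m * exp (- c * norm \<xi>) * cmod (f \<xi>))"
proof -
  have "integrable lebesgue (\<lambda>\<xi>::'a. norm \<xi> ^ (2*m) * exp (- (2*c) * norm \<xi>))"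
    using integrable_power_norm_exp[of "2*c" "2*m"] c by (subst integrable_completion) auto
  then have "integrable (lebesgue_on S) (\<lambda>\<xi>::'a. norm \<xi> ^ (2*m) * exp (- (2*c) * norm \<xi>))"
    using S by (intro integrable_restrict_space[THEN iffD2] integrable_mult_indicator) auto
  then have "integrable (lebesgue_on S)
      (\<lambda>\<xi>. norm \<xi> ^ (2*m) * exp (- (2*c) * norm \<xi>) + (cmod (f \<xi>))\<^sup>2)"
    using f2 by simp
  then show ?thesis
  proof (rule Bochner_Integration.integrable_bound)
    have "(\<lambda>\<xi>::'a. norm \<xi> ^ m * exp (- c * norm \<xi>)) \<in> borel_measurable (lebesgue_on S)"
      using S by (intro continuous_borel_measurable_lebesgue_on continuous_intros)
    then show "(\<lambda>\<xi>. norm \<xi> ^ m * exp (- c * norm \<xi>) * cmod (f \<xi>)) \<in> borel_measurable (lebesgue_on S)"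
      using f by measurable
    show "AE \<xi> in lebesgue_on S. norm (norm \<xi> ^ m * exp (- c * norm \<xi>) * cmod (f \<xi>))
        \<le> norm (norm \<xi> ^ (2*m) * exp (- (2*c) * norm \<xi>) + (cmod (f \<xi>))\<^sup>2)"
    proof (rule AE_I2)
      fix \<xi> :: 'a
      define u where "u = norm \<xi> ^ m * exp (- c * norm \<xi>)"
      define v where "v = cmod (f \<xi>)"
      have uv: "u \<ge> 0" "v \<ge> 0" by (auto simp: u_def v_def)
      have u2: "norm \<xi> ^ (2*m) * exp (- (2*c) * norm \<xi>) = u\<^sup>2"
        by (simp add: u_def power_mult_distrib power_even_eq flip: exp_double)
      have "2 * (u * v) \<le> u\<^sup>2 + v\<^sup>2"
        using sum_squares_bound[of u v] by simp
      moreover have "0 \<le> u * v"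
        using uv by simp
      ultimately have "\<bar>u * v\<bar> \<le> \<bar>u\<^sup>2 + v\<^sup>2\<bar>"
        by linarith
      then show "norm (norm \<xi> ^ m * exp (- c * norm \<xi>) * cmod (f \<xi>))
        \<le> norm (norm \<xi> ^ (2*m) * exp (- (2*c) * norm \<xi>) + (cmod (f \<xi>))\<^sup>2)"
        unfolding u2 by (simp add: u_def v_def)
    qed
  qed
qed

lemma L2_weight_sobolev_imp_L2:
  assumes "f \<in> L2_weight S (sobolev_weight \<rho> n)"
  shows "integrable (lebesgue_on S) (\<lambda>\<xi>. (cmod (f \<xi>))\<^sup>2)"
proof (rule integrableI_nonneg)
  have f: "f \<in> borel_measurable (lebesgue_on S)"
    using assms by (simp add: L2_weight_def)
  then show "(\<lambda>\<xi>. (cmod (f \<xi>))\<^sup>2) \<in> borel_measurable (lebesgue_on S)"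
    by measurable
  have w: "1 \<le> sobolev_weight \<rho> n \<xi>" for \<xi>
    using member_le_sum[of 0 "{0..n}" "\<lambda>k. \<rho> \<xi> ^ (2*k)"] by (simp add: sobolev_weight_def)
  have "(\<integral>\<^sup>+\<xi>. ennreal ((cmod (f \<xi>))\<^sup>2) \<partial>lebesgue_on S)
      \<le> (\<integral>\<^sup>+\<xi>. ennreal ((cmod (f \<xi>))\<^sup>2 * sobolev_weight \<rho> n \<xi>) \<partial>lebesgue_on S)"
    using w by (intro nn_integral_mono ennreal_leI) (simp add: mult_le_cancel_left1)
  also have "\<dots> < \<infinity>"
    using assms by (simp add: L2_weight_def)
  finally show "(\<integral>\<^sup>+\<xi>. ennreal ((cmod (f \<xi>))\<^sup>2) \<partial>lebesgue_on S) < \<infinity>" .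
qed auto

section \<open>The kernel of the Fourier--Laplace transform\<close>

lemma bilin_add: "bilin (z + h) \<xi> = bilin z \<xi> + bilin h \<xi>"
  by (simp add: bilin_def algebra_simps sum.distrib)

lemma bilin_cmult: "bilin (c *s z) \<xi> = c * bilin z \<xi>"
  by (simp add: bilin_def algebra_simps sum_distrib_left)

lemma cmod_bilin_le: "cmod (bilin z \<xi>) \<le> norm z * norm \<xi>"
proof -
  have "cmod (bilin z \<xi>) \<le> (\<Sum>j\<in>UNIV. \<bar>cmod (z $ j)\<bar> * \<bar>norm (\<xi> $ j)\<bar>)"
    unfolding bilin_def by (rule order_trans[OF norm_sum]) (simp add: norm_mult)
  also have "\<dots> \<le> norm z * norm \<xi>"
    unfolding norm_vec_def by (rule L2_set_mult_ineq)
  finally show ?thesis .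
qed

lemma cmod_exp_bilin: "cmod (exp (\<i> * bilin z \<xi>)) = exp (- ((\<chi> j. Im (z $ j)) \<bullet> \<xi>))"
  by (simp add: bilin_def inner_vec_def Im_sum)

lemma continuous_on_bilin: "continuous_on A (bilin z)"
  unfolding bilin_def by (intro continuous_intros)

lemma closed_dual_cone: "closed (dual_cone S)"
proof -
  have "dual_cone S = (\<Inter>x\<in>S. {\<xi>. x \<bullet> \<xi> \<ge> 0})"
    by (auto simp: dual_cone_def)
  then show ?thesis
    by (auto intro!: closed_INT closed_halfspace_ge)
qed

text \<open>The point \<open>y - \<delta> \<xi> / \<bar>\<xi>\<bar>\<close> still belongs to \<open>S\<close>, so it pairs nonnegatively with \<open>\<xi>\<close>.\<close>

lemma dual_cone_coercive:
  fixes y :: "'a::real_inner"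
  assumes "cball y \<delta> \<subseteq> S" and "\<delta> \<ge> 0" and "\<xi> \<in> dual_cone S"
  shows "\<delta> * norm \<xi> \<le> y \<bullet> \<xi>"
proof (cases "\<xi> = 0")
  case False
  have "y - (\<delta> / norm \<xi>) *\<^sub>R \<xi> \<in> cball y \<delta>"
    using False assms(2) by (simp add: dist_norm)
  then have "0 \<le> (y - (\<delta> / norm \<xi>) *\<^sub>R \<xi>) \<bullet> \<xi>"
    using assms unfolding dual_cone_def by blast
  also have "\<dots> = y \<bullet> \<xi> - \<delta> * norm \<xi>"
    using False by (simp add: inner_diff_left dot_square_norm power2_eq_square)
  finally show ?thesis by simp
qed auto

lemma norm_exp_minus_one_minus_id_le:
  fixes w :: complex
  shows "cmod (exp w - 1 - w) \<le> exp (cmod w) * (cmod w)\<^sup>2"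
  using Taylor_exp_field[of w 1] by (simp add: power2_eq_square diff_diff_eq)

section \<open>Holomorphy of the Fourier--Laplace transform\<close>

theorem holomorphic_fourier_laplace:
  fixes \<Omega> :: "(real^'d) set"
  assumes "open \<Omega>" and f: "f \<in> borel_measurable (lebesgue_on (dual_cone \<Omega>))"
    and f2: "integrable (lebesgue_on (dual_cone \<Omega>)) (\<lambda>\<xi>. (cmod (f \<xi>))\<^sup>2)"
  shows "holomorphic_vec_on (fourier_laplace \<Omega> f) (tube \<Omega>)"
  unfolding holomorphic_vec_on_def
proof (intro ballI)
  fix z :: "complex^'d" assume z: "z \<in> tube \<Omega>"
  let ?M = "lebesgue_on (dual_cone \<Omega>)"
  define y where "y = (\<chi> j. Im (z $ j))"
  have "y \<in> \<Omega>" using z by (simp add: tube_def y_def)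
  then obtain \<delta> where \<delta>: "\<delta> > 0" "cball y \<delta> \<subseteq> \<Omega>"
    using \<open>open \<Omega>\<close> open_contains_cball by blast
  have S: "dual_cone \<Omega> \<in> sets lebesgue"
    using borel_closed[OF closed_dual_cone] sets_completionI_sets by fastforce
  define G where "G m \<xi> = norm \<xi> ^ m * exp (- (\<delta>/2) * norm \<xi>) * cmod (f \<xi>)" for m :: nat and \<xi>
  have G: "integrable ?M (G m)" for m
    unfolding G_def using \<delta> by (intro integrable_power_norm_exp_mult_L2 S f f2) auto
  define E where "E \<xi> = exp (\<i> * bilin z \<xi>)" for \<xi>
  have spM: "\<xi> \<in> dual_cone \<Omega>" if "\<xi> \<in> space ?M" for \<xi>
    using that by simp
  have meas: "(\<lambda>\<xi>. bilin h \<xi>) \<in> borel_measurable ?M" for h :: "complex^'d"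
    using continuous_on_bilin S by (rule continuous_borel_measurable_lebesgue_on)
  have E_meas: "E \<in> borel_measurable ?M"
    using meas[of z] unfolding E_def by measurable
  have E_le: "cmod (E \<xi>) \<le> exp (- \<delta> * norm \<xi>)" if "\<xi> \<in> dual_cone \<Omega>" for \<xi>
    using dual_cone_coercive[OF \<delta>(2) _ that] \<delta>(1)
    unfolding E_def cmod_exp_bilin y_def by simp

  \<comment> \<open>Allowing a perturbation \<open>h\<close> here covers the integrands at \<open>z\<close> and at \<open>z + h\<close> and the remainder:
    half of the decay of the kernel absorbs the growth of \<open>e\<^bsup>i\<langle>h, \<xi>\<rangle>\<^esup>\<close>.\<close>
  have bound: "exp (cmod (bilin h \<xi>)) * cmod (E \<xi>) * cmod (f \<xi>) \<le> G 0 \<xi>"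
    if "\<xi> \<in> dual_cone \<Omega>" "norm h \<le> \<delta>/2" for h \<xi>
  proof -
    have "cmod (bilin h \<xi>) \<le> \<delta>/2 * norm \<xi>"
      using cmod_bilin_le[of h \<xi>] mult_right_mono[OF that(2), of "norm \<xi>"] by simp
    then have "exp (cmod (bilin h \<xi>)) * cmod (E \<xi>) \<le> exp (\<delta>/2 * norm \<xi>) * exp (- \<delta> * norm \<xi>)"
      using E_le[OF that(1)] by (intro mult_mono) auto
    also have "\<dots> = exp (- (\<delta>/2) * norm \<xi>)"
      by (simp add: field_simps flip: exp_add)
    finally show ?thesis
      by (simp add: G_def mult_right_mono)
  qed
  have integ: "integrable ?M (\<lambda>\<xi>. exp (\<i> * bilin (z + h) \<xi>) * f \<xi>)" if "norm h \<le> \<delta>/2" for h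
  proof (rule Bochner_Integration.integrable_bound[OF G[of 0]])
    show "(\<lambda>\<xi>. exp (\<i> * bilin (z + h) \<xi>) * f \<xi>) \<in> borel_measurable ?M"
      using meas[of "z + h"] f by measurable
    show "AE \<xi> in ?M. norm (exp (\<i> * bilin (z + h) \<xi>) * f \<xi>) \<le> norm (G 0 \<xi>)"
    proof (rule AE_I2)
      fix \<xi> assume "\<xi> \<in> space ?M"
      note \<xi> = spM[OF this]
      have "cmod (exp (\<i> * bilin (z + h) \<xi>) * f \<xi>)
          = cmod (exp (\<i> * bilin h \<xi>)) * cmod (E \<xi>) * cmod (f \<xi>)"
        by (simp add: bilin_add E_def distrib_left exp_add norm_mult)
      also have "\<dots> \<le> exp (cmod (bilin h \<xi>)) * cmod (E \<xi>) * cmod (f \<xi>)"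
        using norm_exp[of "\<i> * bilin h \<xi>"]
        by (intro mult_right_mono) (auto simp: norm_mult)
      also have "\<dots> \<le> G 0 \<xi>"
        using bound \<xi> that by blast
      finally show "norm (exp (\<i> * bilin (z + h) \<xi>) * f \<xi>) \<le> norm (G 0 \<xi>)"
        by simp
    qed
  qed
  define D where "D h = (\<integral>\<xi>. \<i> * bilin h \<xi> * E \<xi> * f \<xi> \<partial>?M)" for h
  have D_meas: "(\<lambda>\<xi>. \<i> * bilin h \<xi> * E \<xi> * f \<xi>) \<in> borel_measurable ?M" for h
    using meas[of h] E_meas f by measurable
  have D_bound: "cmod (\<i> * bilin h \<xi> * E \<xi> * f \<xi>) \<le> norm h * G 1 \<xi>" if "\<xi> \<in> dual_cone \<Omega>" for h \<xi>
  proof -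
    have "cmod (E \<xi>) * cmod (f \<xi>) \<le> G 0 \<xi>"
      using bound[OF that, of 0] \<delta> by (simp add: bilin_def)
    then have "cmod (bilin h \<xi>) * (cmod (E \<xi>) * cmod (f \<xi>)) \<le> (norm h * norm \<xi>) * G 0 \<xi>"
      using cmod_bilin_le by (intro mult_mono) auto
    then show ?thesis
      by (simp add: norm_mult G_def mult_ac)
  qed
  have D_integ: "integrable ?M (\<lambda>\<xi>. \<i> * bilin h \<xi> * E \<xi> * f \<xi>)" for h
  proof (rule Bochner_Integration.integrable_bound[OF integrable_mult_right[OF G[of 1], of "norm h"] D_meas])
    show "AE \<xi> in ?M. norm (\<i> * bilin h \<xi> * E \<xi> * f \<xi>) \<le> norm (norm h * G 1 \<xi>)"
      using D_bound spM by (intro AE_I2) (metis abs_ge_self order_trans real_norm_def)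
  qed
  have D_cmult: "D (c *s h) = c * D h" for c h
    unfolding D_def bilin_cmult
    by (subst integral_mult_right_zero[symmetric]) (simp add: mult_ac)
  have D_lin: "bounded_linear D"
  proof (rule bounded_linear_intro)
    show "D (h + k) = D h + D k" for h k
      unfolding D_def bilin_add
      by (subst Bochner_Integration.integral_add[OF D_integ D_integ, symmetric])
         (simp add: algebra_simps)
    show "D (r *\<^sub>R h) = r *\<^sub>R D h" for r h
      using D_cmult[of "of_real r" h]
      by (simp add: vector_scalar_mult_def scaleR_vec_def scaleR_conv_of_real[where 'a=complex])
    show "norm (D h) \<le> norm h * (\<integral>\<xi>. G 1 \<xi> \<partial>?M)" for h
      unfolding D_def
      using Bochner_Integration.integral_norm_bound_integral[OF D_integ integrable_mult_right[OF G[of 1], of "norm h"]]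
        D_bound spM by auto
  qed
  define K where "K = (\<integral>\<xi>. G 2 \<xi> \<partial>?M)"
  have remainder: "cmod (fourier_laplace \<Omega> f (z + h) - fourier_laplace \<Omega> f z - D h) \<le> (norm h)\<^sup>2 * K"
    if h: "norm h \<le> \<delta>/2" for h
  proof -
    let ?R = "\<lambda>\<xi>. exp (\<i> * bilin (z + h) \<xi>) * f \<xi> - E \<xi> * f \<xi> - \<i> * bilin h \<xi> * E \<xi> * f \<xi>"
    have E_integ: "integrable ?M (\<lambda>\<xi>. E \<xi> * f \<xi>)"
      using integ[of 0] \<delta> by (simp add: E_def)
    have R_bound: "cmod (?R \<xi>) \<le> (norm h)\<^sup>2 * G 2 \<xi>" if \<xi>: "\<xi> \<in> dual_cone \<Omega>" for \<xi>
    proof -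
      define w where "w = \<i> * bilin h \<xi>"
      have cw: "cmod w = cmod (bilin h \<xi>)" by (simp add: w_def norm_mult)
      have "?R \<xi> = (exp w - 1 - w) * (E \<xi> * f \<xi>)"
        by (simp add: w_def E_def bilin_add distrib_left exp_add algebra_simps)
      then have "cmod (?R \<xi>) \<le> exp (cmod w) * (cmod w)\<^sup>2 * (cmod (E \<xi>) * cmod (f \<xi>))"
        using norm_exp_minus_one_minus_id_le[of w] by (simp add: norm_mult mult_right_mono)
      also have "\<dots> = (cmod w)\<^sup>2 * (exp (cmod (bilin h \<xi>)) * cmod (E \<xi>) * cmod (f \<xi>))"
        by (simp add: cw mult_ac)
      also have "\<dots> \<le> (norm h * norm \<xi>)\<^sup>2 * G 0 \<xi>"
        using bound[OF \<xi> h] cmod_bilin_le[of h \<xi>] unfolding cw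
        by (intro mult_mono power_mono) auto
      also have "\<dots> = (norm h)\<^sup>2 * G 2 \<xi>"
        by (simp add: G_def power_mult_distrib mult_ac)
      finally show ?thesis .
    qed
    have "fourier_laplace \<Omega> f (z + h) - fourier_laplace \<Omega> f z - D h = (\<integral>\<xi>. ?R \<xi> \<partial>?M)"
      using integ[OF h] E_integ D_integ[of h]
      by (simp add: fourier_laplace_def D_def flip: E_def)
    also have "cmod \<dots> \<le> (\<integral>\<xi>. (norm h)\<^sup>2 * G 2 \<xi> \<partial>?M)"
      using integ[OF h] E_integ D_integ[of h] R_bound spM
      by (intro Bochner_Integration.integral_norm_bound_integral integrable_mult_right G) auto
    also have "\<dots> = (norm h)\<^sup>2 * K" by (simp add: K_def)
    finally show ?thesis .
  qed
  have "(fourier_laplace \<Omega> f has_derivative D) (at z)"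
  proof (rule has_derivativeI_sandwich[where e = "\<delta>/2" and H = "\<lambda>v. norm (v - z) * K"])
    fix v assume v: "v \<noteq> z" "dist v z < \<delta>/2"
    have "norm (fourier_laplace \<Omega> f v - fourier_laplace \<Omega> f z - D (v - z)) \<le> (norm (v - z))\<^sup>2 * K"
      using remainder[of "v - z"] v by (simp add: dist_norm)
    then show "norm (fourier_laplace \<Omega> f v - fourier_laplace \<Omega> f z - D (v - z)) / norm (v - z)
        \<le> norm (v - z) * K"
      using v by (simp add: field_simps power2_eq_square)
  next
    show "((\<lambda>v. norm (v - z) * K) \<longlongrightarrow> 0) (at z)"
      by (rule tendsto_eq_intros refl | simp)+
  qed (use \<delta> D_lin in auto)
  then show "\<exists>F'. (fourier_laplace \<Omega> f has_derivative F') (at z) \<and> (\<forall>c v. F' (c *s v) = c * F' v)"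
    using D_cmult by blast
qed

section \<open>Carleson measures\<close>

lemma le_Inf_square:
  fixes X :: ennreal and C :: real
  assumes "A \<noteq> {}" and nonneg: "\<And>a. a \<in> A \<Longrightarrow> a \<ge> 0" and "C > 0"
    and le: "\<And>a. a \<in> A \<Longrightarrow> X \<le> ennreal (C * a\<^sup>2)"
  shows "X \<le> ennreal (C * (Inf A)\<^sup>2)"
proof -
  obtain a where "a \<in> A" using assms(1) by blast
  then have "X < top"
    using le[of a] ennreal_less_top le_less_trans by blast
  then obtain x where x: "X = ennreal x" "x \<ge> 0"
    by (cases X) auto
  have "sqrt (x / C) \<le> Inf A"
  proof (rule cInf_greatest[OF assms(1)])
    fix a assume a: "a \<in> A"
    have "x \<le> C * a\<^sup>2"
      using le[OF a] \<open>C > 0\<close> by (simp add: x(1) ennreal_le_iff)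
    then show "sqrt (x / C) \<le> a"
      using nonneg[OF a] \<open>C > 0\<close> by (intro real_le_lsqrt) (auto simp: field_simps)
  qed
  then have "(sqrt (x / C))\<^sup>2 \<le> (Inf A)\<^sup>2"
    using x(2) \<open>C > 0\<close> by (intro power_mono) auto
  then have "x \<le> C * (Inf A)\<^sup>2"
    using x(2) \<open>C > 0\<close> by (simp add: field_simps)
  then show ?thesis
    by (simp add: x(1) ennreal_leI)
qed

lemma L2_norm_sobolev_nonneg: "L2_norm S (sobolev_weight \<rho> n) f \<ge> 0"
  unfolding L2_norm_def sobolev_weight_def
  by (auto intro!: integral_nonneg_AE mult_nonneg_nonneg sum_nonneg)

theorem theorem7p3:
  fixes \<Omega> :: "(real^'d) set"
    and \<rho> :: "real^'d \<Rightarrow> real"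
    and n :: nat
    and \<mu> :: "(complex^'d) measure"
  assumes "\<Omega> \<noteq> {}" and "open \<Omega>" and "convex \<Omega>" and "positive_cone \<Omega>"
    and "\<not> contains_line \<Omega>"
    and "continuous_on (dual_cone \<Omega>) \<rho>"
    and "\<And>\<xi>. \<xi> \<in> dual_cone \<Omega> \<Longrightarrow> \<rho> \<xi> \<ge> 0"
    and "\<And>\<xi>. \<xi> \<in> dual_cone \<Omega> \<Longrightarrow> \<xi> \<noteq> 0 \<Longrightarrow> \<rho> \<xi> > 0"
    and "\<And>t \<xi>. t > 0 \<Longrightarrow> \<xi> \<in> dual_cone \<Omega> \<Longrightarrow> \<rho> (t *\<^sub>R \<xi>) = t * \<rho> \<xi>"
    and "sets \<mu> = sets (restrict_space borel (tube \<Omega>))"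
  shows "carleson_measure \<Omega> \<rho> n \<mu> \<longleftrightarrow>
    (\<exists>C>0. \<forall>f\<in>L2_weight (dual_cone \<Omega>) (sobolev_weight \<rho> n).
      (\<integral>\<^sup>+z. ennreal ((cmod (fourier_laplace \<Omega> f z))\<^sup>2) \<partial>\<mu>)
        \<le> ennreal (C * (L2_norm (dual_cone \<Omega>) (sobolev_weight \<rho> n) f)\<^sup>2))"
    (is "_ \<longleftrightarrow> (\<exists>C>0. \<forall>f\<in>?L2. ?I f \<le> ennreal (C * (?norm f)\<^sup>2))")
proof
  assume "carleson_measure \<Omega> \<rho> n \<mu>"
  then obtain C where C: "C > 0" and carleson:
    "\<And>F. F \<in> hardy_sobolev \<Omega> \<rho> n \<Longrightarrow>
      (\<integral>\<^sup>+z. ennreal ((cmod (F z))\<^sup>2) \<partial>\<mu>) \<le> ennreal (C * (hardy_sobolev_norm \<Omega> \<rho> n F)\<^sup>2)"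
    unfolding carleson_measure_def by blast
  have "?I f \<le> ennreal (C * (?norm f)\<^sup>2)" if f: "f \<in> ?L2" for f
  proof -
    let ?F = "fourier_laplace \<Omega> f"
    have pre: "f \<in> laplace_preimages \<Omega> \<rho> n ?F"
      using f by (simp add: laplace_preimages_def)
    have "holomorphic_vec_on ?F (tube \<Omega>)"
      using f L2_weight_sobolev_imp_L2[OF f]
      by (intro holomorphic_fourier_laplace \<open>open \<Omega>\<close>) (auto simp: L2_weight_def)
    then have "?F \<in> hardy_sobolev \<Omega> \<rho> n"
      using pre by (auto simp: hardy_sobolev_def)
    then have "?I f \<le> ennreal (C * (hardy_sobolev_norm \<Omega> \<rho> n ?F)\<^sup>2)"
      by (rule carleson)
    also have "\<dots> \<le> ennreal (C * (?norm f)\<^sup>2)"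
    proof -
      have "hardy_sobolev_norm \<Omega> \<rho> n ?F \<le> ?norm f"
        unfolding hardy_sobolev_norm_def
        by (rule cINF_lower[OF bdd_belowI2[where m = 0] pre]) (rule L2_norm_sobolev_nonneg)
      moreover have "0 \<le> hardy_sobolev_norm \<Omega> \<rho> n ?F"
        unfolding hardy_sobolev_norm_def using pre
        by (intro cINF_greatest L2_norm_sobolev_nonneg) auto
      ultimately show ?thesis
        using C by (intro ennreal_leI mult_left_mono power_mono) auto
    qed
    finally show ?thesis .
  qed
  then show "\<exists>C>0. \<forall>f\<in>?L2. ?I f \<le> ennreal (C * (?norm f)\<^sup>2)"
    using C by blast
next
  assume "\<exists>C>0. \<forall>f\<in>?L2. ?I f \<le> ennreal (C * (?norm f)\<^sup>2)"
  then obtain C where C: "C > 0" and laplace: "\<And>f. f \<in> ?L2 \<Longrightarrow> ?I f \<le> ennreal (C * (?norm f)\<^sup>2)"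
    by blast
  have space: "space \<mu> = tube \<Omega>"
    using sets_eq_imp_space_eq[OF assms(10)] by (simp add: space_restrict_space)
  have "(\<integral>\<^sup>+z. ennreal ((cmod (F z))\<^sup>2) \<partial>\<mu>) \<le> ennreal (C * (hardy_sobolev_norm \<Omega> \<rho> n F)\<^sup>2)"
    if F: "F \<in> hardy_sobolev \<Omega> \<rho> n" for F
    unfolding hardy_sobolev_norm_def
  proof (rule le_Inf_square)
    show "?norm ` laplace_preimages \<Omega> \<rho> n F \<noteq> {}"
      using F by (simp add: hardy_sobolev_def)
    fix a assume "a \<in> ?norm ` laplace_preimages \<Omega> \<rho> n F"
    then obtain f where a: "a = ?norm f" and f: "f \<in> ?L2"
      and eq: "\<And>z. z \<in> tube \<Omega> \<Longrightarrow> F z = fourier_laplace \<Omega> f z"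
      by (auto simp: laplace_preimages_def)
    show "a \<ge> 0"
      using a L2_norm_sobolev_nonneg by simp
    have "(\<integral>\<^sup>+z. ennreal ((cmod (F z))\<^sup>2) \<partial>\<mu>) = ?I f"
      by (rule nn_integral_cong) (simp add: eq space)
    then show "(\<integral>\<^sup>+z. ennreal ((cmod (F z))\<^sup>2) \<partial>\<mu>) \<le> ennreal (C * a\<^sup>2)"
      using laplace[OF f] a by simp
  qed (rule C)
  then show "carleson_measure \<Omega> \<rho> n \<mu>"
    unfolding carleson_measure_def using C by blast
qed

end
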